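(* Let $V$ be a valuation ring with nontrivial value group $G$. Then the following are equivalent: (a) $V[\![X]\!]$ is an Ohm-Rush $V$-algebra. (b) $V[\![X]\!]$ is a Gaussian $V$-algebra. (c) $G\cong\mathbb{R}$ or $G\cong\mathbb{Z}$ (isomorphisms of ordered abelian groups, where $\mathbb{R}$ and $\mathbb{Z}$ are additive groups with their usual orders).
   Context: A valuation ring is an integral domain $V$ whose ideals are totally ordered by inclusion; its value group is the totally ordered abelian group of its associated valuation. $X$ is a single indeterminate. Let $S$ be an $R$-algebra (commutative rings with $1$). For $f\in S$, the (Ohm-Rush) content of $f$ is the ideal $\Omega(f) := \bigcap\{I \subseteq R \text{ ideal} \mid f\in IS\}$ of $R$. $S$ is an Ohm-Rush algebra over $R$ if $f\in\Omega(f)S$ for all $f\in S$. An Ohm-Rush $R$-algebra $S$ is Gaussian over $R$ if $\Omega(fg)=\Omega(f)\Omega(g)$ for all $f,g\in S$. *)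

theory Defs
  imports
    Complex_Main
    "HOL-Algebra.Ideal_Product"
    "HOL-Algebra.Multiplicative_Group"
    "HOL-Algebra.Algebraic_Closure_Type"
    "HOL-Computational_Algebra.Formal_Power_Series"
    "HOL-Computational_Algebra.Polynomial_Factorial"
begin

section \<open>Ohm-Rush and Gaussian algebras\<close>

text \<open>
  An \<open>R\<close>-algebra is given by its structure map \<open>\<phi>\<close> from \<open>R\<close> to \<open>S\<close>; the extended ideal \<open>IS\<close> is
  the ideal of \<open>S\<close> generated by the image of \<open>I\<close>.
\<close>

definition extended_ideal ::
    "('b, 'n) ring_scheme \<Rightarrow> ('a \<Rightarrow> 'b) \<Rightarrow> 'a set \<Rightarrow> 'b set" where
  "extended_ideal S \<phi> I = Idl\<^bsub>S\<^esub> (\<phi> ` I)"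

definition ohm_rush_content ::
    "('a, 'm) ring_scheme \<Rightarrow> ('b, 'n) ring_scheme \<Rightarrow> ('a \<Rightarrow> 'b) \<Rightarrow> 'b \<Rightarrow> 'a set" where
  "ohm_rush_content R S \<phi> f = \<Inter>{I. ideal I R \<and> f \<in> extended_ideal S \<phi> I}"

locale ohm_rush_algebra = ring_hom_cring R S \<phi>
  for R (structure) and S (structure) and \<phi> +
  assumes mem_extended_content:
    "f \<in> carrier S \<Longrightarrow> f \<in> extended_ideal S \<phi> (ohm_rush_content R S \<phi> f)"

locale gaussian_algebra = ohm_rush_algebra R S \<phi>
  for R (structure) and S (structure) and \<phi> +
  assumes content_mult:
    "\<lbrakk>f \<in> carrier S; g \<in> carrier S\<rbrakk> \<Longrightarrow>
      ohm_rush_content R S \<phi> (f \<otimes>\<^bsub>S\<^esub> g)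
        = ideal_prod R (ohm_rush_content R S \<phi> f) (ohm_rush_content R S \<phi> g)"


section \<open>Ordered groups\<close>

record 'a ordered_group = "'a monoid" +
  leq :: "'a \<Rightarrow> 'a \<Rightarrow> bool"

definition additive_ordered_group :: "'a::linordered_ab_group_add ordered_group" where
  "additive_ordered_group = \<lparr>carrier = UNIV, monoid.mult = (+), one = 0, leq = (\<le>)\<rparr>"

definition ordered_group_isomorphic :: "'a ordered_group \<Rightarrow> 'b ordered_group \<Rightarrow> bool" where
  "ordered_group_isomorphic G H \<longleftrightarrow>
    (\<exists>h \<in> iso G H. \<forall>a \<in> carrier G. \<forall>b \<in> carrier G. leq G a b \<longleftrightarrow> leq H (h a) (h b))"


section \<open>Valuation rings and their value groups\<close>

locale valuation_ring = domain R for R (structure) +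
  assumes ideals_total: "\<lbrakk>ideal I R; ideal J R\<rbrakk> \<Longrightarrow> I \<subseteq> J \<or> J \<subseteq> I"

text \<open>
  For an integral domain \<open>V\<close> (the type \<open>'a\<close>) with fraction field \<open>K\<close>, the valuation is the
  projection of the nonzero elements of \<open>K\<close> onto their group modulo the units of \<open>V\<close>. The value
  group is this quotient. It is written multiplicatively, and \<open>v x\<close> is at most \<open>v y\<close> iff
  \<open>y / x\<close> lies in \<open>V\<close>, so that \<open>V\<close> consists of \<open>0\<close> and the elements whose value is at least the
  neutral element. This order is total when \<open>V\<close> is a valuation ring.
\<close>

definition fract_mult_group :: "'a::idom fract monoid" where
  "fract_mult_group = mult_of ring_of_type_algebra"

definition unit_fracts :: "'a::idom fract set" where
  "unit_fracts = to_fract ` Units (ring_of_type_algebra :: 'a ring)"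

definition valuation :: "'a::idom fract \<Rightarrow> 'a fract set" where
  "valuation x = unit_fracts #>\<^bsub>fract_mult_group\<^esub> x"

definition value_group :: "'a::idom fract set ordered_group" where
  "value_group =
    \<lparr>carrier = carrier (fract_mult_group Mod unit_fracts),
     monoid.mult = monoid.mult (fract_mult_group Mod unit_fracts),
     one = monoid.one (fract_mult_group Mod unit_fracts),
     leq = (\<lambda>A B. \<exists>x y. x \<noteq> 0 \<and> y \<noteq> 0 \<and> A = valuation x \<and> B = valuation y
                    \<and> y / x \<in> range to_fract)\<rparr>"

end

theory Submission
  imports Defs
begin

text \<open>
  Over a valuation ring with value group \<open>G\<close> the Ohm-Rush property of \<open>V[[X]]\<close> says that every
  sequence in \<open>V\<close> has a greatest common divisor, that is, every countable set of nonnegative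
  elements of \<open>G\<close> has an infimum. If \<open>n h < g\<close> for all \<open>n\<close> with \<open>h > 0\<close>, the elements \<open>g - n h\<close>
  have no infimum, so \<open>G\<close> is archimedean and embeds in the reals by Hoelder's argument. The image is
  either discrete, hence isomorphic to the integers, or dense, and then closure under countable
  infima makes it all of the reals. Conversely, for \<open>G\<close> the reals or the integers gcds exist, and
  their multiplicativity follows from that of the Gauss norms of radius less than one.
\<close>

section \<open>The value group of an integral domain\<close>

lemma carrier_ring_of_type_algebra [simp]: "carrier ring_of_type_algebra = UNIV"
  and mult_ring_of_type_algebra [simp]: "x \<otimes>\<^bsub>ring_of_type_algebra\<^esub> y = x * y"
  and one_ring_of_type_algebra [simp]: "\<one>\<^bsub>ring_of_type_algebra\<^esub> = 1"
  and zero_ring_of_type_algebra [simp]: "\<zero>\<^bsub>ring_of_type_algebra\<^esub> = 0"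
  and add_ring_of_type_algebra [simp]: "x \<oplus>\<^bsub>ring_of_type_algebra\<^esub> y = x + y"
  by (simp_all add: ring_of_type_algebra_def)

lemma mult_fract_mult_group [simp]: "monoid.mult fract_mult_group = (*)"
  by (simp add: fract_mult_group_def ring_of_type_algebra_def)

lemma carrier_fract_mult_group [simp]: "carrier fract_mult_group = UNIV - {0}"
  by (simp add: fract_mult_group_def)

lemma unit_fracts_eq: "unit_fracts = to_fract ` {u. u dvd 1}"
  by (auto simp: unit_fracts_def Units_def dvd_def mult.commute)

lemma valuation_eq_image: "valuation x = (\<lambda>u. u * x) ` unit_fracts"
  by (auto simp: valuation_def r_coset_def)

lemma one_in_unit_fracts [simp]: "1 \<in> unit_fracts"
  by (auto simp: unit_fracts_eq intro!: image_eqI[of _ _ 1])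

text \<open>This form speaks only of membership in the domain, so equality of cosets can be compared
  directly with the order of \<open>value_group\<close>.\<close>

lemma unit_fracts_iff:
  "x \<in> unit_fracts \<longleftrightarrow> x \<noteq> 0 \<and> x \<in> range to_fract \<and> inverse x \<in> range to_fract"
proof
  assume "x \<in> unit_fracts"
  then obtain u v where uv: "x = to_fract u" "u * v = 1"
    unfolding unit_fracts_eq by (metis (mono_tags) dvd_def imageE mem_Collect_eq)
  then have "x * to_fract v = 1"
    by (metis to_fract_1 to_fract_mult)
  then show "x \<noteq> 0 \<and> x \<in> range to_fract \<and> inverse x \<in> range to_fract"
    by (metis inverse_unique mult_zero_left rangeI uv(1) zero_neq_one)
next
  assume "x \<noteq> 0 \<and> x \<in> range to_fract \<and> inverse x \<in> range to_fract"
  then obtain u v where uv: "x \<noteq> 0" "x = to_fract u" "inverse x = to_fract v"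
    by auto
  then have "to_fract (u * v) = to_fract 1"
    by (metis right_inverse to_fract_1 to_fract_mult)
  then have "u * v = 1"
    by (simp only: to_fract_eq_iff)
  then show "x \<in> unit_fracts"
    unfolding unit_fracts_eq uv(2) by (metis dvd_triv_left image_eqI mem_Collect_eq)
qed

lemma range_to_fract_mult:
  "x \<in> range to_fract \<Longrightarrow> y \<in> range to_fract \<Longrightarrow> x * y \<in> range to_fract"
  by (auto simp flip: to_fract_mult)

lemma unit_fracts_mult:
  "x \<in> unit_fracts \<Longrightarrow> y \<in> unit_fracts \<Longrightarrow> x * y \<in> unit_fracts"
  by (simp add: unit_fracts_iff range_to_fract_mult)

lemma valuation_eq_iff:
  assumes "x \<noteq> 0" "y \<noteq> 0"
  shows "valuation x = valuation y \<longleftrightarrow> y / x \<in> unit_fracts"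
proof
  assume eq: "valuation x = valuation y"
  have "y \<in> valuation y"
    unfolding valuation_eq_image by (rule image_eqI[where x = 1]) simp_all
  then have "y \<in> valuation x"
    by (simp only: eq)
  then obtain u where "u \<in> unit_fracts" "y = u * x"
    unfolding valuation_eq_image by blast
  then show "y / x \<in> unit_fracts"
    using assms(1) by simp
next
  assume u: "y / x \<in> unit_fracts"
  then have v: "x / y \<in> unit_fracts"
    using assms by (simp add: unit_fracts_iff)
  have "valuation a \<subseteq> valuation b"
    if ab: "a / b \<in> unit_fracts" "b \<noteq> 0" for a b :: "'a fract"
  proof
    fix z assume "z \<in> valuation a"
    then obtain c where "c \<in> unit_fracts" "z = c * a"
      by (auto simp: valuation_eq_image)
    then have "z = (c * (a / b)) * b" "c * (a / b) \<in> unit_fracts"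
      using ab(2) unit_fracts_mult[OF _ ab(1)] by simp_all
    then show "z \<in> valuation b"
      unfolding valuation_eq_image by (rule image_eqI)
  qed
  then show "valuation x = valuation y"
    using u v assms by blast
qed

lemma carrier_value_group: "carrier value_group = valuation ` (UNIV - {0})"
  by (simp add: value_group_def carrier_FactGroup valuation_def)

lemma one_value_group: "\<one>\<^bsub>value_group\<^esub> = valuation 1"
  by (simp add: value_group_def valuation_eq_image)

lemma mult_value_group: "valuation x \<otimes>\<^bsub>value_group\<^esub> valuation y = valuation (x * y)"
proof -
  have "valuation x \<otimes>\<^bsub>value_group\<^esub> valuation y
      = {u * x * (v * y) | u v. u \<in> unit_fracts \<and> v \<in> unit_fracts}"
    by (auto simp: value_group_def set_mult_def valuation_eq_image)
  also have "\<dots> = valuation (x * y)"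
  proof (intro equalityI subsetI)
    fix z assume "z \<in> {u * x * (v * y) | u v. u \<in> unit_fracts \<and> v \<in> unit_fracts}"
    then obtain u v where "u \<in> unit_fracts" "v \<in> unit_fracts" "z = u * x * (v * y)"
      by auto
    then show "z \<in> valuation (x * y)"
      unfolding valuation_eq_image
      by (intro image_eqI[of _ _ "u * v"] unit_fracts_mult) (simp_all add: ac_simps)
  next
    fix z assume "z \<in> valuation (x * y)"
    then obtain u where "u \<in> unit_fracts" "z = u * (x * y)"
      by (auto simp: valuation_eq_image)
    then have "z = u * x * (1 * y)" "u \<in> unit_fracts" "1 \<in> (unit_fracts :: 'a fract set)"
      by (simp_all add: ac_simps)
    then show "z \<in> {u * x * (v * y) | u v. u \<in> unit_fracts \<and> v \<in> unit_fracts}"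
      by blast
  qed
  finally show ?thesis .
qed

text \<open>The order is existential over representatives. Changing them multiplies the quotient by
  \<open>x' / x\<close> and \<open>y / y'\<close>, both units, so any nonzero pair decides
  it.\<close>

lemma leq_value_group:
  assumes "x \<noteq> 0" "y \<noteq> 0"
  shows "leq value_group (valuation x) (valuation y) \<longleftrightarrow> y / x \<in> range to_fract"
proof
  assume "leq value_group (valuation x) (valuation y)"
  then obtain x' y' where *: "x' \<noteq> 0" "y' \<noteq> 0" "valuation x = valuation x'"
      "valuation y = valuation y'" "y' / x' \<in> range to_fract"
    unfolding value_group_def by auto
  then have "x' / x \<in> range to_fract" "y / y' \<in> range to_fract"
    using assms by (auto simp: valuation_eq_iff unit_fracts_iff)
  then have "x' / x * (y / y') * (y' / x') \<in> range to_fract"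
    using * by (intro range_to_fract_mult)
  then show "y / x \<in> range to_fract"
    using * by simp
next
  assume "y / x \<in> range to_fract"
  then show "leq value_group (valuation x) (valuation y)"
    unfolding value_group_def using assms by auto
qed

lemma to_fract_divide_in_range_iff:
  assumes "a \<noteq> 0"
  shows "to_fract b / to_fract a \<in> range to_fract \<longleftrightarrow> a dvd b"
proof
  assume "to_fract b / to_fract a \<in> range to_fract"
  then obtain c where "to_fract b / to_fract a = to_fract c"
    by auto
  then have "to_fract b = to_fract (a * c)"
    using assms by (simp add: field_simps)
  then show "a dvd b"
    by (simp only: to_fract_eq_iff dvd_triv_left)
next
  assume "a dvd b"
  then obtain c where "b = a * c" ..
  then have "to_fract b / to_fract a = to_fract c"
    using assms by simp
  then show "to_fract b / to_fract a \<in> range to_fract"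
    by simp
qed

section \<open>Valuations with values in an arbitrary ordered group\<close>

lemma fract_to_fract_cases:
  obtains a b where "b \<noteq> 0" "x = to_fract a / to_fract b"
  by (metis Fract_cases Fract_conv_to_fract)

text \<open>A valuation restricted to the nonzero elements of the domain; \<open>w 0\<close> is
  unconstrained, so 0 is treated separately below. \<open>dvd_iff\<close> stands in for the
  ultrametric inequality, which follows from it.\<close>

locale divisibility_valuation =
  fixes w :: "'a::idom \<Rightarrow> 'g::linordered_ab_group_add"
  assumes val_mult: "a \<noteq> 0 \<Longrightarrow> b \<noteq> 0 \<Longrightarrow> w (a * b) = w a + w b"
    and dvd_iff: "a \<noteq> 0 \<Longrightarrow> b \<noteq> 0 \<Longrightarrow> a dvd b \<longleftrightarrow> w a \<le> w b"
begin

lemma val_one [simp]: "w 1 = 0"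
  using val_mult[of 1 1] by simp

lemma val_nonneg: "a \<noteq> 0 \<Longrightarrow> 0 \<le> w a"
  using dvd_iff[of 1 a] by simp

text \<open>Cross-multiplying two representations of a fraction turns into an equality of sums of
  values, so \<open>w a - w b\<close> is independent of the representation and the choice by
  \<open>SOME\<close> is harmless.\<close>

lemma extends_to_fract:
  obtains W where "\<And>a b. a \<noteq> 0 \<Longrightarrow> b \<noteq> 0 \<Longrightarrow> W (to_fract a / to_fract b) = w a - w b"
proof -
  define P where "P x g \<longleftrightarrow> (\<exists>a b. a \<noteq> 0 \<and> b \<noteq> 0 \<and> x = to_fract a / to_fract b \<and> g = w a - w b)"
    for x g
  define W where "W x = (SOME g. P x g)" for x
  have "W (to_fract a / to_fract b) = w a - w b" if ab: "a \<noteq> 0" "b \<noteq> 0" for a b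
  proof -
    have "P (to_fract a / to_fract b) (w a - w b)"
      using ab unfolding P_def by blast
    then have "P (to_fract a / to_fract b) (W (to_fract a / to_fract b))"
      unfolding W_def by (rule someI)
    then obtain c d where cd: "c \<noteq> 0" "d \<noteq> 0" "to_fract a / to_fract b = to_fract c / to_fract d"
        "W (to_fract a / to_fract b) = w c - w d"
      unfolding P_def by blast
    then have "to_fract (a * d) = to_fract (c * b)"
      using ab by (simp add: field_simps)
    then have "a * d = c * b"
      by (simp only: to_fract_eq_iff)
    then have "w a + w d = w c + w b"
      using ab cd by (metis val_mult)
    then show ?thesis
      unfolding cd(4) by (simp add: algebra_simps)
  qed
  then show ?thesis
    using that by blast
qed

text \<open>The extension \<open>W\<close> is nonnegative exactly on the fractions in the domain.
  Hence equal values force both quotients into the domain, that is, equal cosets, and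
  \<open>W\<close> descends to an order embedding of the value group. Inverses supply the negative
  values, so \<open>onto\<close> concerns only \<open>g \<ge> 0\<close>.\<close>

lemma value_group_isomorphic:
  assumes onto: "\<And>g. 0 \<le> g \<Longrightarrow> \<exists>a. a \<noteq> 0 \<and> w a = g"
  shows "ordered_group_isomorphic (value_group :: 'a fract set ordered_group)
    (additive_ordered_group :: 'g ordered_group)"
proof -
  obtain W where W: "\<And>a b. a \<noteq> 0 \<Longrightarrow> b \<noteq> 0 \<Longrightarrow> W (to_fract a / to_fract b) = w a - w b"
    by (rule extends_to_fract) blast
  have W_mult: "W (x * y) = W x + W y" if "x \<noteq> 0" "y \<noteq> 0" for x y
  proof -
    obtain a b c d where abcd: "b \<noteq> 0" "x = to_fract a / to_fract b"
        "d \<noteq> 0" "y = to_fract c / to_fract d"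
      by (metis fract_to_fract_cases)
    then have "x * y = to_fract (a * c) / to_fract (b * d)"
      by simp
    then show ?thesis
      using abcd that by (simp add: W val_mult del: to_fract_mult)
  qed
  have W_range: "x \<in> range to_fract \<longleftrightarrow> 0 \<le> W x" if "x \<noteq> 0" for x
  proof -
    obtain a b where ab: "b \<noteq> 0" "x = to_fract a / to_fract b"
      by (rule fract_to_fract_cases)
    then show ?thesis
      using that by (simp add: W dvd_iff to_fract_divide_in_range_iff)
  qed
  have W_divide: "W (y / x) = W y - W x" if "x \<noteq> 0" "y \<noteq> 0" for x y
    using W_mult[of "y / x" x] that by (simp add: algebra_simps)
  have W_leq: "leq value_group (valuation x) (valuation y) \<longleftrightarrow> W x \<le> W y"
    if "x \<noteq> 0" "y \<noteq> 0" for x y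
    using that by (simp add: leq_value_group W_range W_divide)
  have W_cong: "W x = W y \<longleftrightarrow> valuation x = valuation y" if "x \<noteq> 0" "y \<noteq> 0" for x y
  proof
    assume "W x = W y"
    then have "y / x \<in> range to_fract" "x / y \<in> range to_fract"
      using that by (simp_all add: W_range W_divide)
    then show "valuation x = valuation y"
      using that by (simp add: valuation_eq_iff unit_fracts_iff)
  next
    assume "valuation x = valuation y"
    then have "y / x \<in> range to_fract" "x / y \<in> range to_fract"
      using that by (simp_all add: valuation_eq_iff unit_fracts_iff)
    then show "W x = W y"
      using that by (simp add: W_range W_divide)
  qed
  have W_onto: "\<exists>x. x \<noteq> 0 \<and> W x = g" for g
  proof (cases "0 \<le> g")
    case True
    then obtain a where "a \<noteq> 0" "w a = g"
      using onto by blast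
    then show ?thesis
      using W[of a 1] by (intro exI[of _ "to_fract a"]) simp
  next
    case False
    then obtain a where "a \<noteq> 0" "w a = - g"
      using onto[of "- g"] by (metis linear neg_0_le_iff_le)
    then show ?thesis
      using W[of 1 a] by (intro exI[of _ "1 / to_fract a"]) simp
  qed
  \<comment> \<open>\<open>W_cong\<close> makes the value independent of the chosen representative
    of the coset.\<close>
  define h where "h A = W (SOME x. x \<noteq> 0 \<and> A = valuation x)" for A
  have h: "h (valuation x) = W x" if "x \<noteq> 0" for x
  proof -
    define y where "y = (SOME y. y \<noteq> 0 \<and> valuation x = valuation y)"
    have "y \<noteq> 0 \<and> valuation x = valuation y"
      unfolding y_def by (rule someI[where x = x]) (use that in simp)
    then have "W y = W x"
      using W_cong that by simp
    then show ?thesis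
      by (simp add: h_def y_def)
  qed
  have "h \<in> iso value_group additive_ordered_group"
    unfolding iso_def hom_def bij_betw_def
  proof (intro CollectI conjI ballI)
    show "h \<in> carrier value_group \<rightarrow> carrier additive_ordered_group"
      by (simp add: additive_ordered_group_def)
  next
    fix A B :: "'a fract set"
    assume "A \<in> carrier value_group" "B \<in> carrier value_group"
    then obtain x y where "x \<noteq> 0" "A = valuation x" "y \<noteq> 0" "B = valuation y"
      by (auto simp: carrier_value_group)
    then show "h (A \<otimes>\<^bsub>value_group\<^esub> B) = h A \<otimes>\<^bsub>additive_ordered_group\<^esub> h B"
      by (simp add: mult_value_group h W_mult additive_ordered_group_def)
  next
    show "inj_on h (carrier value_group)"
      by (auto simp: inj_on_def carrier_value_group h W_cong)
  next
    have "g \<in> h ` carrier value_group" for g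
    proof -
      obtain x where "x \<noteq> 0" "W x = g"
        using W_onto by blast
      then show ?thesis
        by (intro image_eqI[of _ _ "valuation x"]) (auto simp: h carrier_value_group)
    qed
    then show "h ` carrier value_group = carrier additive_ordered_group"
      by (auto simp: additive_ordered_group_def)
  qed
  moreover have "leq value_group A B \<longleftrightarrow> leq additive_ordered_group (h A) (h B)"
    if "A \<in> carrier value_group" "B \<in> carrier value_group" for A B
    using that by (auto simp: carrier_value_group h W_leq additive_ordered_group_def)
  ultimately show ?thesis
    unfolding ordered_group_isomorphic_def by blast
qed

end

lemma divisibility_valuation_of_isomorphic:
  assumes "ordered_group_isomorphic (value_group :: 'a fract set ordered_group)
    (additive_ordered_group :: 'g ordered_group)"
  obtains w :: "'a::idom \<Rightarrow> 'g::linordered_ab_group_add" where "divisibility_valuation w"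
    "\<And>g. 0 \<le> g \<Longrightarrow> \<exists>a. a \<noteq> 0 \<and> w a = g"
proof -
  obtain h :: "'a fract set \<Rightarrow> 'g" where h: "h \<in> iso value_group additive_ordered_group"
    and h_leq: "\<And>A B. A \<in> carrier value_group \<Longrightarrow> B \<in> carrier value_group \<Longrightarrow>
      leq value_group A B \<longleftrightarrow> leq additive_ordered_group (h A) (h B)"
    using assms unfolding ordered_group_isomorphic_def by blast
  have carr: "valuation x \<in> carrier value_group" if "x \<noteq> 0" for x :: "'a fract"
    using that by (simp add: carrier_value_group)
  have h_mult: "h (valuation (x * y)) = h (valuation x) + h (valuation y)"
    if "x \<noteq> 0" "y \<noteq> 0" for x y
    using h carr[OF that(1)] carr[OF that(2)]
    by (simp add: iso_def hom_def additive_ordered_group_def mult_value_group[symmetric])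
  have h_le: "h (valuation x) \<le> h (valuation y) \<longleftrightarrow> y / x \<in> range to_fract"
    if "x \<noteq> 0" "y \<noteq> 0" for x y
    using h_leq[OF carr[OF that(1)] carr[OF that(2)]] that
    by (simp add: additive_ordered_group_def leq_value_group)
  define w where "w a = h (valuation (to_fract a))" for a
  have "divisibility_valuation w"
    by unfold_locales (simp_all add: w_def h_mult h_le to_fract_divide_in_range_iff)
  moreover have "\<exists>a. a \<noteq> 0 \<and> w a = g" if "0 \<le> g" for g
  proof -
    have "g \<in> h ` carrier value_group"
      using h by (auto simp: iso_def bij_betw_def additive_ordered_group_def)
    then obtain x where x: "x \<noteq> 0" "g = h (valuation x)"
      by (auto simp: carrier_value_group)
    \<comment> \<open>Comparison with the coset of 1 shows that a fraction of nonnegative value lies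
      in the domain, so \<open>g\<close> is attained there.\<close>
    have "h (valuation 1) = 0"
      using h_mult[of 1 1] by simp
    then have "x \<in> range to_fract"
      using h_le[of 1 x] x that by simp
    then show ?thesis
      using x by (auto simp: w_def)
  qed
  ultimately show ?thesis
    using that by blast
qed

text \<open>If every nonzero element were a unit, every nonzero fraction would lie in
  \<open>unit_fracts\<close>, leaving only the coset of 1.\<close>

lemma nontrivial_value_group:
  assumes "carrier (value_group :: 'a fract set ordered_group) \<noteq> {\<one>\<^bsub>value_group\<^esub>}"
  obtains u :: "'a::idom" where "u \<noteq> 0" "\<not> u dvd 1"
proof -
  have "\<exists>u::'a. u \<noteq> 0 \<and> \<not> u dvd 1"
  proof (rule ccontr)
    assume "\<not> ?thesis"
    then have unit: "u dvd 1" if "u \<noteq> 0" for u :: 'a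
      using that by blast
    have "x \<in> unit_fracts" if "x \<noteq> 0" for x :: "'a fract"
    proof -
      obtain a b where ab: "b \<noteq> 0" "x = to_fract a / to_fract b"
        by (rule fract_to_fract_cases)
      with that have "a \<noteq> 0"
        by auto
      with ab have "a dvd b" "b dvd a"
        using unit[of a] unit[of b] by (meson dvd_trans one_dvd)+
      then have "to_fract a / to_fract b \<in> range to_fract" "to_fract b / to_fract a \<in> range to_fract"
        using to_fract_divide_in_range_iff ab(1) \<open>a \<noteq> 0\<close> by blast+
      moreover have "inverse x = to_fract b / to_fract a"
        by (simp only: ab(2) inverse_divide)
      ultimately show ?thesis
        using that ab(2) unfolding unit_fracts_iff by metis
    qed
    then have eq: "valuation x = valuation 1" if "x \<noteq> 0" for x :: "'a fract"
      using that valuation_eq_iff[of 1 x] by simp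
    have "valuation ` (UNIV - {0 :: 'a fract}) = (\<lambda>_. valuation 1) ` (UNIV - {0 :: 'a fract})"
      by (intro image_cong refl eq) blast
    also have "\<dots> = {valuation 1}"
      by (rule image_constant[of 1]) simp
    finally have "carrier (value_group :: 'a fract set ordered_group) = {\<one>\<^bsub>value_group\<^esub>}"
      by (simp only: carrier_value_group one_value_group)
    with assms show False
      by simp
  qed
  then show ?thesis
    using that by blast
qed

section \<open>Contents of power series and greatest common divisors\<close>

lemma ideal_ring_of_type_algebra_iff:
  "ideal I (ring_of_type_algebra :: 'a::comm_ring_1 ring) \<longleftrightarrow>
    0 \<in> I \<and> (\<forall>x\<in>I. \<forall>y\<in>I. x + y \<in> I) \<and> (\<forall>x\<in>I. \<forall>r. r * x \<in> I)"
proof (intro iffI conjI ballI allI)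
  assume I: "ideal I (ring_of_type_algebra :: 'a ring)"
  interpret ideal I "ring_of_type_algebra :: 'a ring" by (rule I)
  show "0 \<in> I"
    using additive_subgroup.zero_closed[OF additive_subgroup_axioms] by simp
  show "x + y \<in> I" if "x \<in> I" "y \<in> I" for x y
    using additive_subgroup.a_closed[OF additive_subgroup_axioms that] by simp
  show "r * x \<in> I" if "x \<in> I" for x r
    using I_l_closed[OF that, of r] by simp
next
  assume *: "0 \<in> I \<and> (\<forall>x\<in>I. \<forall>y\<in>I. x + y \<in> I) \<and> (\<forall>x\<in>I. \<forall>r. r * x \<in> I)"
  interpret R: ring "ring_of_type_algebra :: 'a ring" ..
  have minus: "\<ominus>\<^bsub>ring_of_type_algebra\<^esub> x = - x" for x :: 'a
    using R.minus_equality[of "- x" x] by simp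
  show "ideal I (ring_of_type_algebra :: 'a ring)"
  proof (rule idealI)
    show "subgroup I (add_monoid (ring_of_type_algebra :: 'a ring))"
    proof (rule R.add.subgroupI)
      show "\<ominus>\<^bsub>ring_of_type_algebra\<^esub> x \<in> I" if "x \<in> I" for x
        unfolding minus using * that by (metis mult_minus1)
    qed (use * in auto)
  qed (use * in \<open>auto simp: mult.commute intro: R.ring_axioms\<close>)
qed

lemma ideal_multiples: "ideal {x. c dvd x} (ring_of_type_algebra :: 'a::comm_ring_1 ring)"
  by (simp add: ideal_ring_of_type_algebra_iff)

lemma valuation_ring_dvd_total:
  assumes "valuation_ring (ring_of_type_algebra :: 'a::idom ring)"
  shows "a dvd b \<or> b dvd (a::'a)"
proof -
  have "{x. a dvd x} \<subseteq> {x. b dvd x} \<or> {x. b dvd x} \<subseteq> {x. a dvd x}"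
    by (rule valuation_ring.ideals_total[OF assms ideal_multiples ideal_multiples])
  then show ?thesis
    by (metis dvd_refl mem_Collect_eq subsetD)
qed

section \<open>Extended ideals and contents in power series rings\<close>

lemma fps_const_dvd_iff: "fps_const c dvd f \<longleftrightarrow> (\<forall>n. c dvd fps_nth f n)"
proof
  assume "fps_const c dvd f"
  then show "\<forall>n. c dvd fps_nth f n"
    by (auto simp: dvd_def)
next
  assume "\<forall>n. c dvd fps_nth f n"
  then obtain g where "fps_nth f n = c * g n" for n
    unfolding dvd_def by metis
  then have "f = fps_const c * Abs_fps g"
    by (simp add: fps_eq_iff)
  then show "fps_const c dvd f" ..
qed

text \<open>An element of the extended ideal is a finite combination of constants from
  \<open>I\<close>. Since of two constants one divides the other, a single constant divides the
  whole sum, even if \<open>I\<close> is not finitely generated.\<close>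

lemma extended_ideal_fps:
  assumes total: "\<And>a b :: 'a::idom. a dvd b \<or> b dvd a"
    and I: "ideal I (ring_of_type_algebra :: 'a ring)"
  shows "extended_ideal (ring_of_type_algebra :: 'a fps ring) fps_const I
    = {f. \<exists>c\<in>I. fps_const c dvd f}"
proof -
  have I': "0 \<in> I" "\<And>x y. x \<in> I \<Longrightarrow> y \<in> I \<Longrightarrow> x + y \<in> I" "\<And>x r. x \<in> I \<Longrightarrow> r * x \<in> I"
    using I by (auto simp: ideal_ring_of_type_algebra_iff)
  have "\<exists>e\<in>I. fps_const e dvd f + g"
    if "c \<in> I" "fps_const c dvd f" "d \<in> I" "fps_const d dvd g" for c d f g
  proof (cases "c dvd d")
    case True
    then have "fps_const c dvd g"
      using that by (auto simp: fps_const_dvd_iff intro: dvd_trans)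
    then show ?thesis
      using that by (meson dvd_add)
  next
    case False
    then have "d dvd c"
      using total by blast
    then have "fps_const d dvd f"
      using that by (auto simp: fps_const_dvd_iff intro: dvd_trans)
    then show ?thesis
      using that by (meson dvd_add)
  qed
  then have ideal: "ideal {f. \<exists>c\<in>I. fps_const c dvd f} (ring_of_type_algebra :: 'a fps ring)"
    using I' by (auto simp: ideal_ring_of_type_algebra_iff intro: dvd_mult)
  show ?thesis
    unfolding extended_ideal_def genideal_def
  proof (intro equalityI Inter_greatest Inter_lower; clarsimp?)
    show "ideal {f. \<exists>c\<in>I. fps_const c dvd f} ring_of_type_algebra \<and>
        fps_const ` I \<subseteq> {f. \<exists>c\<in>I. fps_const c dvd f}"
      using ideal by (auto intro: dvd_refl)
  next
    fix J :: "'a fps set" and c f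
    assume "ideal J ring_of_type_algebra" "fps_const ` I \<subseteq> J" "c \<in> I" "fps_const c dvd f"
    then show "f \<in> J"
      unfolding ideal_ring_of_type_algebra_iff dvd_def by (metis image_subset_iff mult.commute)
  qed
qed

text \<open>The universal property in one equivalence: \<open>x = c\<close> shows that
  \<open>c\<close> is itself a common divisor. It fixes \<open>c\<close> up to associates; for a
  valuation, \<open>v c\<close> is the infimum of the values.\<close>

definition is_seq_gcd :: "'a::comm_monoid_mult \<Rightarrow> (nat \<Rightarrow> 'a) \<Rightarrow> bool" where
  "is_seq_gcd c f \<longleftrightarrow> (\<forall>x. x dvd c \<longleftrightarrow> (\<forall>n. x dvd f n))"

lemma is_seq_gcd_dvd: "is_seq_gcd c f \<Longrightarrow> c dvd f n"
  unfolding is_seq_gcd_def using dvd_refl by metis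

text \<open>Principal ideals suffice in the intersection: an ideal whose extension contains
  \<open>f\<close> contains some constant \<open>c\<close> dividing \<open>f\<close>, hence all
  multiples of \<open>c\<close>, and these already form an ideal of the same kind.\<close>

lemma ohm_rush_content_fps:
  assumes total: "\<And>a b :: 'a::idom. a dvd b \<or> b dvd a"
  shows "ohm_rush_content (ring_of_type_algebra :: 'a ring) ring_of_type_algebra fps_const f
    = {x. \<forall>c. fps_const c dvd f \<longrightarrow> c dvd x}" (is "?L = ?R")
proof
  show "?L \<subseteq> ?R"
  proof clarify
    fix x c assume "x \<in> ?L" "fps_const c dvd f"
    moreover have "f \<in> extended_ideal ring_of_type_algebra fps_const {x. c dvd x}"
      unfolding extended_ideal_fps[OF total ideal_multiples]
      using \<open>fps_const c dvd f\<close> dvd_refl[of c] by blast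
    ultimately have "x \<in> {x. c dvd x}"
      unfolding ohm_rush_content_def using ideal_multiples[of c] by blast
    then show "c dvd x"
      by simp
  qed
  show "?R \<subseteq> ?L"
    unfolding ohm_rush_content_def
  proof clarify
    fix x I
    assume x: "\<forall>c. fps_const c dvd f \<longrightarrow> c dvd x" and I: "ideal I ring_of_type_algebra"
      and "f \<in> extended_ideal ring_of_type_algebra fps_const I"
    then obtain c where "c \<in> I" "c dvd x"
      by (auto simp: extended_ideal_fps[OF total I])
    then show "x \<in> I"
      using I unfolding ideal_ring_of_type_algebra_iff dvd_def by (metis mult.commute)
  qed
qed

lemma ohm_rush_content_seq_gcd:
  assumes total: "\<And>a b :: 'a::idom. a dvd b \<or> b dvd a" and c: "is_seq_gcd c (fps_nth f)"
  shows "ohm_rush_content (ring_of_type_algebra :: 'a ring) ring_of_type_algebra fps_const f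
    = {x. c dvd x}"
proof -
  have "(\<forall>d. fps_const d dvd f \<longrightarrow> d dvd x) \<longleftrightarrow> c dvd x" for x
    using c dvd_refl[of c] dvd_trans unfolding is_seq_gcd_def fps_const_dvd_iff by metis
  then show ?thesis
    by (simp add: ohm_rush_content_fps[OF total])
qed

lemma ring_hom_cring_fps_const:
  "ring_hom_cring (ring_of_type_algebra :: 'a::idom ring) ring_of_type_algebra fps_const"
proof -
  interpret R: cring "ring_of_type_algebra :: 'a ring" ..
  interpret S: cring "ring_of_type_algebra :: 'a fps ring" ..
  show ?thesis
    by unfold_locales (auto simp: ring_hom_def)
qed

text \<open>\<open>f\<close> lies in the extension of its content iff some \<open>c\<close> in the
  content divides \<open>f\<close>. Membership of \<open>c\<close> in the content says that every
  common divisor of the coefficients divides \<open>c\<close>, so such a \<open>c\<close> is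
  precisely their gcd.\<close>

lemma ohm_rush_fps_iff:
  assumes total: "\<And>a b :: 'a::idom. a dvd b \<or> b dvd a"
  shows "ohm_rush_algebra (ring_of_type_algebra :: 'a ring) ring_of_type_algebra fps_const
    \<longleftrightarrow> (\<forall>f :: nat \<Rightarrow> 'a. \<exists>c. is_seq_gcd c f)"
proof -
  define C where "C = ohm_rush_content (ring_of_type_algebra :: 'a ring)
    (ring_of_type_algebra :: 'a fps ring) fps_const"
  have C: "C f = {x. \<forall>c. fps_const c dvd f \<longrightarrow> c dvd x}" for f
    unfolding C_def by (rule ohm_rush_content_fps[OF total])
  have "ideal (C f) ring_of_type_algebra" for f
    by (simp add: C ideal_ring_of_type_algebra_iff)
  then have "f \<in> extended_ideal ring_of_type_algebra fps_const (C f)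
      \<longleftrightarrow> (\<exists>c\<in>C f. fps_const c dvd f)" for f
    by (simp add: extended_ideal_fps[OF total])
  moreover have "(\<exists>c\<in>C f. fps_const c dvd f) \<longleftrightarrow> (\<exists>c. is_seq_gcd c (fps_nth f))" for f
  proof -
    have "is_seq_gcd c (fps_nth f) \<longleftrightarrow> c \<in> C f \<and> fps_const c dvd f" for c
      unfolding C is_seq_gcd_def fps_const_dvd_iff mem_Collect_eq
      using dvd_refl[of c] dvd_trans by metis
    then show ?thesis
      by blast
  qed
  ultimately have "ohm_rush_algebra (ring_of_type_algebra :: 'a ring) ring_of_type_algebra fps_const
    \<longleftrightarrow> (\<forall>f :: 'a fps. \<exists>c. is_seq_gcd c (fps_nth f))"
    unfolding ohm_rush_algebra_def ohm_rush_algebra_axioms_def C_def[symmetric]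
    by (simp add: ring_hom_cring_fps_const)
  also have "\<dots> \<longleftrightarrow> (\<forall>f :: nat \<Rightarrow> 'a. \<exists>c. is_seq_gcd c f)"
    by (metis fps_nth_Abs_fps ext)
  finally show ?thesis .
qed

lemma ideal_prod_multiples:
  "ideal_prod (ring_of_type_algebra :: 'a::comm_ring_1 ring) {x. c dvd x} {x. d dvd x}
    = {x. c * d dvd x}" (is "?P = _")
proof (intro equalityI subsetI)
  fix x assume "x \<in> ?P"
  then have "c * d dvd x"
    by (induction rule: ideal_prod.induct) (auto intro: mult_dvd_mono)
  then show "x \<in> {x. c * d dvd x}" by simp
next
  fix x assume "x \<in> {x. c * d dvd x}"
  then obtain k where "x = c * (d * k)"
    by (auto simp: dvd_def mult.assoc)
  then show "x \<in> ?P"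
    using ideal_prod.prod[of c "{x. c dvd x}" "d * k" "{x. d dvd x}" ring_of_type_algebra]
    by simp
qed

text \<open>Contents are principal, generated by gcds of coefficients, so multiplicativity of
  contents reduces to that of gcds.\<close>

lemma gaussian_fpsI:
  assumes total: "\<And>a b :: 'a::idom. a dvd b \<or> b dvd a"
    and gcds: "\<And>f :: nat \<Rightarrow> 'a. \<exists>c. is_seq_gcd c f"
    and mult: "\<And>c d :: 'a. \<And>f g. is_seq_gcd c (fps_nth f) \<Longrightarrow> is_seq_gcd d (fps_nth g)
      \<Longrightarrow> is_seq_gcd (c * d) (fps_nth (f * g))"
  shows "gaussian_algebra (ring_of_type_algebra :: 'a ring) ring_of_type_algebra fps_const"
proof (intro gaussian_algebra.intro gaussian_algebra_axioms.intro)
  show "ohm_rush_algebra (ring_of_type_algebra :: 'a ring) ring_of_type_algebra fps_const"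
    using gcds by (simp add: ohm_rush_fps_iff[OF total])
next
  fix f g :: "'a fps"
  obtain c d where cd: "is_seq_gcd c (fps_nth f)" "is_seq_gcd d (fps_nth g)"
    using gcds by metis
  show "ohm_rush_content (ring_of_type_algebra :: 'a ring) ring_of_type_algebra fps_const
      (f \<otimes>\<^bsub>ring_of_type_algebra\<^esub> g)
    = ideal_prod (ring_of_type_algebra :: 'a ring)
      (ohm_rush_content ring_of_type_algebra ring_of_type_algebra fps_const f)
      (ohm_rush_content ring_of_type_algebra ring_of_type_algebra fps_const g)"
    using ohm_rush_content_seq_gcd[OF total mult[OF cd]]
      ohm_rush_content_seq_gcd[OF total cd(1)] ohm_rush_content_seq_gcd[OF total cd(2)]
    by (simp add: ideal_prod_multiples)
qed

section \<open>Archimedean valuations\<close>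

lemma power_dvd_power_iff:
  assumes "u \<noteq> 0" "\<not> u dvd (1 :: 'a::idom)"
  shows "u ^ p dvd u ^ q \<longleftrightarrow> p \<le> q"
proof
  assume dvd: "u ^ p dvd u ^ q"
  show "p \<le> q"
  proof (rule ccontr)
    assume "\<not> p \<le> q"
    then obtain k where "p = q + Suc k"
      by (metis less_imp_Suc_add not_le add_Suc_right)
    then have "u ^ q * (u * u ^ k) dvd u ^ q * 1"
      using dvd by (simp add: power_add)
    then have "u * u ^ k dvd 1"
      using assms by (simp only: dvd_mult_cancel_left) simp
    then show False
      using assms by (meson dvd_mult_left)
  qed
qed (rule le_imp_power_dvd)

text \<open>If all powers of \<open>z\<close> divide \<open>x = z ^ n * y n\<close>, cancellation
  gives \<open>y n = z * y (Suc n)\<close>. For a gcd \<open>d\<close> of the \<open>y n\<close>,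
  also \<open>z * d\<close> divides every \<open>y n\<close>, hence divides \<open>d\<close>, which
  makes \<open>z\<close> a unit.\<close>

lemma archimedean_of_seq_gcds:
  assumes total: "\<And>a b :: 'a::idom. a dvd b \<or> b dvd a"
    and gcds: "\<And>f :: nat \<Rightarrow> 'a. \<exists>c. is_seq_gcd c f"
    and "x \<noteq> (0::'a)" "z \<noteq> 0" "\<not> z dvd 1"
  shows "\<exists>n. x dvd z ^ n"
proof (rule ccontr)
  assume "\<not> ?thesis"
  then have "\<forall>n. \<exists>y. x = z ^ n * y"
    using total unfolding dvd_def by metis
  then obtain y where y: "\<And>n. x = z ^ n * y n"
    by metis
  have step: "y n = z * y (Suc n)" for n
    using y[of n] y[of "Suc n"] \<open>z \<noteq> 0\<close> by (simp add: mult.assoc mult.left_commute)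
  obtain d where d: "is_seq_gcd d y"
    using gcds by blast
  have "z * d dvd y n" for n
    unfolding step[of n] using is_seq_gcd_dvd[OF d] by (intro mult_dvd_mono) auto
  then have "z * d dvd 1 * d"
    using d by (simp add: is_seq_gcd_def)
  moreover have "d \<noteq> 0"
    using is_seq_gcd_dvd[OF d, of 0] y[of 0] \<open>x \<noteq> 0\<close> by auto
  ultimately show False
    using \<open>\<not> z dvd 1\<close> by (simp only: dvd_mult_cancel_right) simp
qed

section \<open>Hoelder's embedding into the reals\<close>

lemma nonneg_rational_between:
  assumes "0 \<le> x" "x < (y :: real)"
  obtains p q :: nat where "q > 0" "x < real p / real q" "real p / real q < y"
proof -
  obtain r where r: "r \<in> \<rat>" "x < r" "r < y"
    using Rats_dense_in_real[OF assms(2)] by blast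
  then obtain p q :: nat where "q \<noteq> 0" "\<bar>r\<bar> = real p / real q"
    by (meson Rats_abs_nat_div_natE)
  then show ?thesis
    using that[of q p] r assms by auto
qed

text \<open>The element \<open>u\<close> is the unit of measurement: \<open>u ^ p dvd x ^ q\<close>
  places \<open>p / q\<close> below the value of \<open>x\<close>, the reversed divisibility places
  it above, and totality of divisibility leaves no gap. The value is the supremum of this
  cut.\<close>

lemma exists_real_valuation:
  fixes u :: "'a::idom"
  assumes total: "\<And>a b :: 'a. a dvd b \<or> b dvd a"
    and arch: "\<And>x z :: 'a. x \<noteq> 0 \<Longrightarrow> z \<noteq> 0 \<Longrightarrow> \<not> z dvd 1 \<Longrightarrow> \<exists>n. x dvd z ^ n"
    and u: "u \<noteq> 0" "\<not> u dvd 1"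
  shows "\<exists>w :: 'a \<Rightarrow> real. divisibility_valuation w"
proof -
  define S where "S x = {real p / real q | p q. q > 0 \<and> u ^ p dvd x ^ q}" for x :: 'a
  define w where "w x = Sup (S x)" for x
  \<comment> \<open>Raising the hypotheses to the powers \<open>s\<close> and \<open>q\<close>
    brings both to \<open>x ^ (s * q)\<close>, leaving a divisibility between powers of the nonunit
    \<open>u\<close>.\<close>
  have le_quotient: "real r / real s \<le> real p / real q"
    if "x ^ q dvd u ^ p" "q > 0" "u ^ r dvd x ^ s" "s > 0" for x p q r s
  proof -
    have "u ^ (r * q) dvd x ^ (s * q)"
      using dvd_power_same[OF that(3), of q] by (simp add: power_mult)
    also have "x ^ (s * q) dvd u ^ (p * s)"
      using dvd_power_same[OF that(1), of s] by (simp add: power_mult mult.commute[of s])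
    finally have "r * q \<le> p * s"
      using u by (simp add: power_dvd_power_iff)
    then have "real r * real q \<le> real p * real s"
      by (metis of_nat_le_iff of_nat_mult)
    then show ?thesis
      using that by (simp add: divide_simps mult.commute)
  qed
  have nonempty: "0 \<in> S x" for x
    unfolding S_def by (rule CollectI, rule exI[of _ 0], rule exI[of _ 1]) simp
  have bdd: "bdd_above (S x)" if x: "x \<noteq> 0" for x
  proof -
    obtain n where "x ^ 1 dvd u ^ n"
      using arch[OF x u] by auto
    then have "real p / real q \<le> real n / real 1" if "u ^ p dvd x ^ q" "q > 0" for p q
      using that by (intro le_quotient) simp_all
    then show ?thesis
      unfolding S_def by (intro bdd_aboveI[of _ "real n / real 1"]) blast
  qed
  have lower: "real p / real q \<le> w x" if "x \<noteq> 0" "u ^ p dvd x ^ q" "q > 0" for x p q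
    unfolding w_def using that bdd by (intro cSup_upper) (auto simp: S_def)
  have upper: "w x \<le> real p / real q" if "x ^ q dvd u ^ p" "q > 0" for x p q
    unfolding w_def
  proof (rule cSup_least)
    show "S x \<noteq> {}"
      using nonempty by blast
    show "s \<le> real p / real q" if s: "s \<in> S x" for s
      using s le_quotient[OF \<open>x ^ q dvd u ^ p\<close> \<open>q > 0\<close>] unfolding S_def by blast
  qed
  have nonneg: "0 \<le> w x" if "x \<noteq> 0" for x
    using lower[OF that, of 0 1] by simp
  have below: "\<exists>p q. q > 0 \<and> u ^ p dvd x ^ q \<and> r < real p / real q" if "r < w x" for x r
  proof -
    have "\<exists>s\<in>S x. r < s"
      using less_cSupD[of "S x" r] that nonempty[of x] unfolding w_def by blast
    then show ?thesis
      unfolding S_def by blast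
  qed
  \<comment> \<open>A rational above the supremum is outside the cut, so totality gives the reversed
    divisibility.\<close>
  have above: "\<exists>p q. q > 0 \<and> x ^ q dvd u ^ p \<and> real p / real q < r" if x: "x \<noteq> 0" "w x < r" for x r
  proof -
    obtain p q where pq: "q > 0" "w x < real p / real q" "real p / real q < r"
      using nonneg_rational_between[OF nonneg[OF x(1)] x(2)] .
    then have "\<not> u ^ p dvd x ^ q"
      using lower[OF x(1), of p q] by linarith
    then show ?thesis
      using pq total by blast
  qed
  have u_powers: "(u ^ p) ^ s * (u ^ r) ^ q = u ^ (p * s + r * q)" for p q r s
    by (simp add: power_add power_mult)
  have mult_powers: "(x ^ q) ^ s * (y ^ s) ^ q = (x * y) ^ (q * s)" for x y :: 'a and q s
    by (simp only: power_mult_distrib power_mult[of x q s, symmetric]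
        power_mult[of y s q, symmetric] mult.commute[of s q])
  \<comment> \<open>Rational approximations \<open>p / q\<close> and \<open>r / s\<close> of the two
    values, each within \<open>e / 2\<close>, are brought to the common exponent
    \<open>q * s\<close>; multiplying the divisibilities approximates the value of the product by
    their sum.\<close>
  have add: "w (x * y) = w x + w y" if xy: "x \<noteq> 0" "y \<noteq> 0" for x y
  proof (rule antisym)
    show "w (x * y) \<le> w x + w y"
    proof (rule field_le_epsilon)
      fix e :: real assume "0 < e"
      obtain p q where pq: "q > 0" "x ^ q dvd u ^ p" "real p / real q < w x + e / 2"
        using above[OF xy(1), of "w x + e / 2"] \<open>0 < e\<close> by auto
      obtain r s where rs: "s > 0" "y ^ s dvd u ^ r" "real r / real s < w y + e / 2"
        using above[OF xy(2), of "w y + e / 2"] \<open>0 < e\<close> by auto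
      have "(x ^ q) ^ s * (y ^ s) ^ q dvd (u ^ p) ^ s * (u ^ r) ^ q"
        using pq rs by (intro mult_dvd_mono dvd_power_same)
      then have "(x * y) ^ (q * s) dvd u ^ (p * s + r * q)"
        by (simp only: u_powers mult_powers)
      then have "w (x * y) \<le> real (p * s + r * q) / real (q * s)"
        using pq(1) rs(1) by (intro upper) simp_all
      also have "\<dots> = real p / real q + real r / real s"
        using pq(1) rs(1) by (simp add: add_frac_eq)
      finally show "w (x * y) \<le> w x + w y + e"
        using pq rs by linarith
    qed
    show "w x + w y \<le> w (x * y)"
    proof (rule field_le_epsilon)
      fix e :: real assume "0 < e"
      obtain p q where pq: "q > 0" "u ^ p dvd x ^ q" "w x - e / 2 < real p / real q"
        using below[of "w x - e / 2" x] \<open>0 < e\<close> by auto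
      obtain r s where rs: "s > 0" "u ^ r dvd y ^ s" "w y - e / 2 < real r / real s"
        using below[of "w y - e / 2" y] \<open>0 < e\<close> by auto
      have "(u ^ p) ^ s * (u ^ r) ^ q dvd (x ^ q) ^ s * (y ^ s) ^ q"
        using pq rs by (intro mult_dvd_mono dvd_power_same)
      then have "u ^ (p * s + r * q) dvd (x * y) ^ (q * s)"
        by (simp only: u_powers mult_powers)
      then have "real (p * s + r * q) / real (q * s) \<le> w (x * y)"
        using pq(1) rs(1) xy by (intro lower) simp_all
      also have "real (p * s + r * q) / real (q * s) = real p / real q + real r / real s"
        using pq(1) rs(1) by (simp add: add_frac_eq)
      finally show "w x + w y \<le> w (x * y) + e"
        using pq rs by linarith
    qed
  qed
  have "x dvd y \<longleftrightarrow> w x \<le> w y" if xy: "x \<noteq> 0" "y \<noteq> 0" for x y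
  proof
    assume "x dvd y"
    then obtain z where "y = x * z" ..
    then show "w x \<le> w y"
      using xy add[of x z] nonneg[of z] by auto
  next
    assume le: "w x \<le> w y"
    show "x dvd y"
    proof (rule ccontr)
      \<comment> \<open>Now \<open>x = y * z\<close> with \<open>z\<close> a nonunit. By the
        archimedean property \<open>u\<close> divides some \<open>z ^ n\<close>, so
        \<open>w z\<close> is at least \<open>1 / n\<close> and \<open>w x\<close> exceeds
        \<open>w y\<close>.\<close>
      assume not: "\<not> x dvd y"
      then obtain z where z: "x = y * z"
        using total unfolding dvd_def by metis
      have "z \<noteq> 0"
        using z xy by auto
      have "\<not> z dvd 1"
        using not mult_dvd_mono[of y y z 1] unfolding z by auto
      then obtain n where n: "u dvd z ^ n"
        using arch[OF u(1) \<open>z \<noteq> 0\<close>] by blast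
      then have "n > 0"
        using u(2) by (cases n) auto
      then have "0 < w z"
        using lower[OF \<open>z \<noteq> 0\<close>, of 1 n] n by (auto intro: less_le_trans[of _ "1 / real n"])
      then show False
        using le add[OF xy(2) \<open>z \<noteq> 0\<close>] z by simp
    qed
  qed
  with add have "divisibility_valuation w"
    by unfold_locales auto
  then show ?thesis
    by blast
qed

section \<open>Discrete and dense value sets in the reals\<close>

lemma val_power_real:
  fixes w :: "'a::idom \<Rightarrow> real"
  assumes "divisibility_valuation w" "a \<noteq> 0"
  shows "w (a ^ n) = real n * w a"
proof -
  interpret divisibility_valuation w by fact
  show ?thesis
    by (induction n) (use assms in \<open>auto simp: val_mult algebra_simps\<close>)
qed

text \<open>Division with remainder by the least positive value \<open>w p\<close>: the remainder is
  again a value, that of the cofactor \<open>b\<close> in \<open>a = p ^ n * b\<close>, and lies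
  below \<open>w p\<close>, so it vanishes.\<close>

lemma int_valuation_of_least_value:
  fixes w :: "'a::idom \<Rightarrow> real"
  assumes w: "divisibility_valuation w"
    and p: "p \<noteq> 0" "0 < w p" "\<And>a. a \<noteq> 0 \<Longrightarrow> 0 < w a \<Longrightarrow> w p \<le> w a"
  shows "\<exists>v :: 'a \<Rightarrow> int. divisibility_valuation v \<and> (\<forall>g\<ge>0. \<exists>a. a \<noteq> 0 \<and> v a = g)"
proof -
  interpret divisibility_valuation w by fact
  have w_pow: "w (p ^ n) = real n * w p" for n
    by (rule val_power_real[OF w p(1)])
  have multiple: "\<exists>n::nat. w a = real n * w p" if "a \<noteq> 0" for a
  proof -
    define n where "n = nat \<lfloor>w a / w p\<rfloor>"
    have n: "real n \<le> w a / w p" "w a / w p < real n + 1"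
      using val_nonneg[OF that] p(2) by (simp_all add: n_def)
    then have n': "real n * w p \<le> w a" "w a < real n * w p + w p"
      using p(2) by (simp_all add: field_simps)
    then have "p ^ n dvd a"
      using that p(1) by (simp add: dvd_iff w_pow)
    then obtain b where b: "a = p ^ n * b" ..
    then have "b \<noteq> 0" "w a = real n * w p + w b"
      using that p(1) val_mult[of "p ^ n" b] by (auto simp: w_pow)
    then have "w b = 0"
      using n' p(3)[of b] val_nonneg[of b] by force
    then show ?thesis
      using \<open>w a = real n * w p + w b\<close> by auto
  qed
  \<comment> \<open>For nonzero \<open>a\<close> the quotient is an integer by
    \<open>multiple\<close>, so the floor is exact.\<close>
  define v where "v a = \<lfloor>w a / w p\<rfloor>" for a
  have v: "w a = of_int (v a) * w p" if "a \<noteq> 0" for a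
    using multiple[OF that] p(2) by (auto simp: v_def)
  have "divisibility_valuation v"
  proof
    fix a b :: 'a assume ab: "a \<noteq> 0" "b \<noteq> 0"
    have "of_int (v (a * b)) * w p = of_int (v a + v b) * w p"
      using v[of "a * b"] v[of a] v[of b] val_mult[OF ab] ab by (simp add: distrib_right)
    then show "v (a * b) = v a + v b"
      using p(2) by (simp only: mult_cancel_right of_int_eq_iff) simp
    show "a dvd b \<longleftrightarrow> v a \<le> v b"
      using v[of a] v[of b] dvd_iff[OF ab] ab p(2) by simp
  qed
  moreover have "\<exists>a. a \<noteq> 0 \<and> v a = g" if "0 \<le> g" for g
    using that p by (intro exI[of _ "p ^ nat g"]) (simp add: v_def w_pow)
  ultimately show ?thesis
    by blast
qed

text \<open>Without a least positive value the values are dense in the nonnegative reals. A sequence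
  of elements whose values tend to \<open>g\<close> from above then has a gcd of value exactly
  \<open>g\<close>.\<close>

lemma real_valuation_onto_of_no_least_value:
  fixes w :: "'a::idom \<Rightarrow> real"
  assumes w: "divisibility_valuation w"
    and gcds: "\<And>f :: nat \<Rightarrow> 'a. \<exists>c. is_seq_gcd c f"
    and u: "u \<noteq> 0" "0 < w u"
    and no_least: "\<And>p. p \<noteq> 0 \<Longrightarrow> 0 < w p \<Longrightarrow> \<exists>a. a \<noteq> 0 \<and> 0 < w a \<and> w a < w p"
    and "0 \<le> g"
  shows "\<exists>a. a \<noteq> 0 \<and> w a = g"
proof -
  interpret divisibility_valuation w by fact
  \<comment> \<open>Otherwise the infimum of the positive values is positive. An \<open>a\<close> of
    value below twice the infimum factors as \<open>b * c\<close> with both values positive, so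
    \<open>w a\<close> is at least twice the infimum.\<close>
  have small: "\<exists>a. a \<noteq> 0 \<and> 0 < w a \<and> w a < e" if "0 < e" for e
  proof (rule ccontr)
    assume no: "\<not> ?thesis"
    define P where "P = w ` {a. a \<noteq> 0 \<and> 0 < w a}"
    have low: "e \<le> x" if "x \<in> P" for x
      using no that unfolding P_def by (auto simp: not_less)
    have "P \<noteq> {}"
      using u unfolding P_def by auto
    have bdd: "bdd_below P"
      using low by (meson bdd_belowI)
    have "e \<le> Inf P"
      using low \<open>P \<noteq> {}\<close> by (meson cInf_greatest)
    then have "Inf P < 2 * Inf P"
      using \<open>0 < e\<close> by linarith
    then obtain a where a: "a \<noteq> 0" "0 < w a" "w a < 2 * Inf P"
      using cInf_lessD[OF \<open>P \<noteq> {}\<close>] unfolding P_def by blast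
    obtain b where b: "b \<noteq> 0" "0 < w b" "w b < w a"
      using no_least[OF a(1,2)] by blast
    then have "b dvd a"
      using a by (simp add: dvd_iff)
    then obtain c where c: "a = b * c" ..
    then have "c \<noteq> 0" "w a = w b + w c"
      using a b val_mult[of b c] by auto
    moreover have "Inf P \<le> w b"
      using b bdd by (intro cInf_lower) (auto simp: P_def)
    moreover have "Inf P \<le> w c"
      using b calculation bdd by (intro cInf_lower) (auto simp: P_def)
    ultimately show False
      using a by linarith
  qed
  have dense: "\<exists>a. a \<noteq> 0 \<and> x < w a \<and> w a < y" if xy: "0 \<le> x" "x < y" for x y
  proof -
    obtain a where a: "a \<noteq> 0" "0 < w a" "w a < y - x"
      using small[of "y - x"] xy by auto
    \<comment> \<open>The multiples of \<open>w a\<close> advance by less than \<open>y - x\<close>,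
      so the first one beyond \<open>x\<close>, with factor \<open>Suc n\<close>, is still below
      \<open>y\<close>.\<close>
    define n where "n = nat \<lfloor>x / w a\<rfloor>"
    have "real n \<le> x / w a" "x / w a < real n + 1"
      using that a by (simp_all add: n_def)
    then have "real n * w a \<le> x" "x < real n * w a + w a"
      using a by (simp_all add: field_simps)
    then have "x < w (a ^ Suc n)" "w (a ^ Suc n) < y"
      unfolding val_power_real[OF w a(1)] using a by (simp_all add: algebra_simps)
    then show ?thesis
      using a(1) by (intro exI[of _ "a ^ Suc n"]) auto
  qed
  have "\<exists>a. a \<noteq> 0 \<and> g < w a \<and> w a < g + 1 / real (Suc n)" for n
    using \<open>0 \<le> g\<close> by (intro dense) auto
  then obtain f where f: "\<And>n. f n \<noteq> 0" "\<And>n. g < w (f n)" "\<And>n. w (f n) < g + 1 / real (Suc n)"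
    by metis
  obtain d where d: "is_seq_gcd d f"
    using gcds by blast
  have "d \<noteq> 0"
    using is_seq_gcd_dvd[OF d, of 0] f(1)[of 0] by auto
  have "w d \<le> g"
  proof (rule field_le_epsilon)
    fix e :: real assume "0 < e"
    then obtain n where "1 / real (Suc n) < e"
      using nat_approx_posE by blast
    moreover have "w d \<le> w (f n)"
      using is_seq_gcd_dvd[OF d, of n] \<open>d \<noteq> 0\<close> f(1) by (simp add: dvd_iff)
    ultimately show "w d \<le> g + e"
      using f(3)[of n] by linarith
  qed
  \<comment> \<open>An element with value strictly between \<open>w d\<close> and \<open>g\<close>
    would be a common divisor of the sequence not dividing its gcd.\<close>
  moreover have "\<not> w d < g"
  proof
    assume "w d < g"
    then obtain a where a: "a \<noteq> 0" "w d < w a" "w a < g"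
      using dense[of "w d" g] val_nonneg[OF \<open>d \<noteq> 0\<close>] by blast
    then have "a dvd f n" for n
      using f(1,2)[of n] by (simp add: dvd_iff)
    then have "a dvd d"
      using d by (simp add: is_seq_gcd_def)
    then show False
      using a \<open>d \<noteq> 0\<close> by (simp add: dvd_iff)
  qed
  ultimately show ?thesis
    using \<open>d \<noteq> 0\<close> by (intro exI[of _ d]) auto
qed

section \<open>Gauss norms\<close>

text \<open>The ultrametric inequality: whichever of \<open>a\<close> and \<open>b\<close> divides
  the other also divides \<open>a + b\<close>. The disjunct for 0 plays the role of an infinite
  value.\<close>

lemma val_add_greater:
  fixes w :: "'a::idom \<Rightarrow> real"
  assumes w: "divisibility_valuation w" and ab: "a = 0 \<or> r < w a" "b = 0 \<or> r < w b"
  shows "a + b = 0 \<or> r < w (a + b)"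
proof (cases "a = 0 \<or> b = 0 \<or> a + b = 0")
  case False
  interpret divisibility_valuation w by fact
  have "a dvd b \<or> b dvd a"
    using False dvd_iff[of a b] dvd_iff[of b a] by linarith
  then have "a dvd a + b \<or> b dvd a + b"
    by auto
  then have "w a \<le> w (a + b) \<or> w b \<le> w (a + b)"
    using False dvd_iff[of a "a + b"] dvd_iff[of b "a + b"] by blast
  then show ?thesis
    using False ab by linarith
qed (use ab in auto)

lemma sum_val_greater:
  fixes w :: "'a::idom \<Rightarrow> real"
  assumes w: "divisibility_valuation w"
    and "\<And>i. i \<in> I \<Longrightarrow> x i = 0 \<or> r < w (x i)"
  shows "sum x I = 0 \<or> r < w (sum x I)"
  using assms(2)
proof (induction I rule: infinite_finite_induct)
  case (insert i I)
  have "x i + sum x I = 0 \<or> r < w (x i + sum x I)"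
    by (rule val_add_greater[OF w]) (use insert in simp_all)
  then show ?case
    using insert.hyps by simp
qed simp_all

text \<open>As \<open>w\<close> is nonnegative and \<open>s > 0\<close>, only finitely many indices
  compete with \<open>k\<close>, so the minimum is attained. Taking the least minimizing index makes
  the inequality strict at smaller indices.\<close>

lemma first_minimizer:
  fixes w :: "'a::zero \<Rightarrow> real"
  assumes nonneg: "\<And>a. a \<noteq> 0 \<Longrightarrow> 0 \<le> w a" and "0 < s" "f k \<noteq> (0::'a)"
  obtains i where "f i \<noteq> 0" "\<And>n. f n \<noteq> 0 \<Longrightarrow> w (f i) + s * real i \<le> w (f n) + s * real n"
    "\<And>n. f n \<noteq> 0 \<Longrightarrow> n < i \<Longrightarrow> w (f i) + s * real i < w (f n) + s * real n"
proof -
  define N where "N n = w (f n) + s * real n" for n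
  define A where "A = {n. f n \<noteq> 0 \<and> N n \<le> N k}"
  have "n \<le> nat \<lceil>N k / s\<rceil>" if "n \<in> A" for n
  proof -
    have "s * real n \<le> N k"
      using that nonneg[of "f n"] by (auto simp: A_def N_def)
    then have "real n \<le> N k / s"
      using \<open>0 < s\<close> by (simp add: field_simps)
    then show ?thesis
      by linarith
  qed
  then have "finite A"
    by (meson finite_nat_set_iff_bounded_le)
  moreover have "k \<in> A"
    using assms by (simp add: A_def)
  ultimately obtain j where j: "j \<in> A" "\<And>n. n \<in> A \<Longrightarrow> N j \<le> N n"
    using arg_min_if_finite(1)[of A N] arg_min_least[of A _ N] by blast
  define i where "i = (LEAST i. i \<in> A \<and> N i = N j)"
  have i: "i \<in> A" "N i = N j"
    using LeastI[of "\<lambda>i. i \<in> A \<and> N i = N j" j] j unfolding i_def by auto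
  have min: "N i \<le> N n" if "f n \<noteq> 0" for n
  proof (cases "n \<in> A")
    case True
    then show ?thesis
      using i(2) j(2) by simp
  next
    case False
    then have "N k < N n"
      using that by (simp add: A_def not_le)
    then show ?thesis
      using i(2) j(2)[OF \<open>k \<in> A\<close>] by linarith
  qed
  moreover have "N i < N n" if "f n \<noteq> 0" "n < i" for n
  proof -
    have "N n \<noteq> N i"
    proof
      assume "N n = N i"
      then have "n \<in> A \<and> N n = N j"
        using i that by (simp add: A_def)
      then show False
        using not_less_Least[of n "\<lambda>i. i \<in> A \<and> N i = N j"] that unfolding i_def by blast
    qed
    with min[OF that(1)] show ?thesis
      by simp
  qed
  ultimately show ?thesis
    using that[of i] i unfolding N_def A_def by auto
qed

text \<open>
  For every \<open>s > 0\<close> the minimum of \<open>w (f\<^sub>n) + s * n\<close> over \<open>n\<close> is attained and additive in \<open>f\<close>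
  (the Gauss norm of radius \<open>exp (- s)\<close>); the lemma follows by taking \<open>s\<close> small.
\<close>

lemma fps_mult_nth_val_less:
  fixes w :: "'a::idom \<Rightarrow> real"
  assumes w: "divisibility_valuation w"
    and fg: "fps_nth f k \<noteq> 0" "fps_nth g l \<noteq> 0" and "0 < e"
  obtains n where "fps_nth (f * g) n \<noteq> 0"
    "w (fps_nth (f * g) n) < w (fps_nth f k) + w (fps_nth g l) + e"
proof -
  interpret divisibility_valuation w by fact
  \<comment> \<open>Small enough that the penalties at \<open>k\<close> and \<open>l\<close>
    together stay below \<open>e\<close>; the added 1 keeps the denominator positive.\<close>
  define s where "s = e / (real k + real l + 1)"
  have s: "0 < s" "s * (real k + real l) < e"
    using \<open>0 < e\<close> by (simp_all add: s_def field_simps)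
  obtain i where i: "fps_nth f i \<noteq> 0"
    "\<And>n. fps_nth f n \<noteq> 0 \<Longrightarrow> w (fps_nth f i) + s * real i \<le> w (fps_nth f n) + s * real n"
    "\<And>n. fps_nth f n \<noteq> 0 \<Longrightarrow> n < i \<Longrightarrow> w (fps_nth f i) + s * real i < w (fps_nth f n) + s * real n"
    using first_minimizer[of w s "fps_nth f" k] val_nonneg s(1) fg(1) by blast
  obtain j where j: "fps_nth g j \<noteq> 0"
    "\<And>n. fps_nth g n \<noteq> 0 \<Longrightarrow> w (fps_nth g j) + s * real j \<le> w (fps_nth g n) + s * real n"
    "\<And>n. fps_nth g n \<noteq> 0 \<Longrightarrow> n < j \<Longrightarrow> w (fps_nth g j) + s * real j < w (fps_nth g n) + s * real n"
    using first_minimizer[of w s "fps_nth g" l] val_nonneg s(1) fg(2) by blast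
  define t where "t = fps_nth f i * fps_nth g j"
  define r where "r = (\<Sum>m\<in>{0..i+j} - {i}. fps_nth f m * fps_nth g (i + j - m))"
  have t: "t \<noteq> 0" "w t = w (fps_nth f i) + w (fps_nth g j)"
    using i(1) j(1) by (simp_all add: t_def val_mult)
  \<comment> \<open>At the sum of the first minimizers, \<open>t\<close> is the one term of least
    value in the convolution, so no cancellation can raise the value of the coefficient.\<close>
  have sum: "fps_nth (f * g) (i + j) = t + r"
    unfolding fps_mult_nth t_def r_def by (subst sum.remove[of _ i]) auto
  have r: "r = 0 \<or> w t < w r"
    unfolding r_def
  proof (rule sum_val_greater[OF w])
    fix m assume m: "m \<in> {0..i+j} - {i}"
    show "fps_nth f m * fps_nth g (i + j - m) = 0 \<or> w t < w (fps_nth f m * fps_nth g (i + j - m))"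
    proof (cases "fps_nth f m = 0 \<or> fps_nth g (i + j - m) = 0")
      case False
      \<comment> \<open>The two indices add up to \<open>i + j\<close>, so if \<open>m\<close>
        differs from \<open>i\<close>, one of them precedes its first minimizer and the inequality
        there is strict.\<close>
      have "m < i \<or> i + j - m < j"
        using m by auto
      then have "w (fps_nth f i) + s * real i + (w (fps_nth g j) + s * real j)
          < w (fps_nth f m) + s * real m + (w (fps_nth g (i + j - m)) + s * real (i + j - m))"
        using False i(2,3)[of m] j(2,3)[of "i + j - m"] by linarith
      moreover have "s * real m + s * real (i + j - m) = s * real i + s * real j"
        using m by (simp add: of_nat_diff flip: distrib_left)
      ultimately show ?thesis
        using False by (simp add: t val_mult)
    qed auto
  qed
  \<comment> \<open>If \<open>t + r\<close> were zero or of larger value than \<open>t\<close>, then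
    \<open>t\<close>, as the difference of \<open>t + r\<close> and \<open>r\<close>, would have
    value larger than its own.\<close>
  have "t + r \<noteq> 0 \<and> w (t + r) \<le> w t"
  proof (rule ccontr)
    assume "\<not> ?thesis"
    then have tr: "t + r = 0 \<or> w t < w (t + r)"
      by auto
    have "w (- r) = w r"
    proof (cases "r = 0")
      case False
      then show ?thesis
        using dvd_iff[of r "- r"] dvd_iff[of "- r" r] by simp
    qed simp
    have "t + r + - r = 0 \<or> w t < w (t + r + - r)"
      by (rule val_add_greater[OF w tr]) (use r \<open>w (- r) = w r\<close> in simp)
    then show False
      using t by simp
  qed
  moreover have "w t < w (fps_nth f k) + w (fps_nth g l) + e"
  proof -
    have "0 \<le> s * real i" "0 \<le> s * real j" "s * real k + s * real l < e"
      using s by (simp_all add: distrib_left)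
    then show ?thesis
      using i(2)[OF fg(1)] j(2)[OF fg(2)] t(2) by linarith
  qed
  ultimately show ?thesis
    using that[of "i + j"] unfolding sum by linarith
qed

text \<open>\<open>approx\<close> expresses that the value of a gcd is the infimum of the values of
  the sequence, attained or not, and so covers discrete and dense values alike. A common divisor of
  the product coefficients not dividing \<open>c * d\<close> would have value above
  \<open>w (c * d)\<close>, yet some coefficient has value in between.\<close>

lemma is_seq_gcd_fps_mult:
  fixes w :: "'a::idom \<Rightarrow> real" and f g :: "'a fps"
  assumes w: "divisibility_valuation w"
    and approx: "\<And>(c :: 'a) f e. is_seq_gcd c f \<Longrightarrow> c \<noteq> 0 \<Longrightarrow> 0 < e \<Longrightarrow>
      \<exists>n. f n \<noteq> 0 \<and> w (f n) < w c + e"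
    and c: "is_seq_gcd c (fps_nth f)" and d: "is_seq_gcd d (fps_nth g)"
  shows "is_seq_gcd (c * d) (fps_nth (f * g))"
  unfolding is_seq_gcd_def
proof (intro allI iffI)
  fix x n assume "x dvd c * d"
  moreover have "fps_const c * fps_const d dvd f * g"
    using is_seq_gcd_dvd[OF c] is_seq_gcd_dvd[OF d]
    by (intro mult_dvd_mono) (simp_all add: fps_const_dvd_iff)
  then have "c * d dvd fps_nth (f * g) n"
    by (simp add: fps_const_dvd_iff)
  ultimately show "x dvd fps_nth (f * g) n"
    by (rule dvd_trans)
next
  interpret divisibility_valuation w by fact
  fix x assume x: "\<forall>n. x dvd fps_nth (f * g) n"
  show "x dvd c * d"
  proof (rule ccontr)
    assume not: "\<not> x dvd c * d"
    then have cd: "c \<noteq> 0" "d \<noteq> 0"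
      by auto
    \<comment> \<open>One third of \<open>e\<close> is spent on each factor and one on the Gauss
      norm estimate for the product.\<close>
    have less: "\<exists>n. fps_nth (f * g) n \<noteq> 0 \<and> w (fps_nth (f * g) n) < w (c * d) + e"
      if "0 < e" for e
    proof -
      obtain k where k: "fps_nth f k \<noteq> 0" "w (fps_nth f k) < w c + e / 3"
        using approx[OF c cd(1), of "e / 3"] \<open>0 < e\<close> by auto
      obtain l where l: "fps_nth g l \<noteq> 0" "w (fps_nth g l) < w d + e / 3"
        using approx[OF d cd(2), of "e / 3"] \<open>0 < e\<close> by auto
      obtain n where n: "fps_nth (f * g) n \<noteq> 0"
          "w (fps_nth (f * g) n) < w (fps_nth f k) + w (fps_nth g l) + e / 3"
        using fps_mult_nth_val_less[OF w k(1) l(1), of "e / 3"] \<open>0 < e\<close> by auto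
      have "w (fps_nth (f * g) n) < w (c * d) + e"
        unfolding val_mult[OF cd] using n(2) k(2) l(2) by linarith
      with n(1) show ?thesis
        by blast
    qed
    have "x \<noteq> 0"
      using less[of 1] x by auto
    with not have "w (c * d) < w x"
      using cd dvd_iff[of x "c * d"] by simp
    then obtain n where n: "fps_nth (f * g) n \<noteq> 0" "w (fps_nth (f * g) n) < w x"
      using less[of "w x - w (c * d)"] by auto
    then show False
      using x \<open>x \<noteq> 0\<close> dvd_iff[of x "fps_nth (f * g) n"] by auto
  qed
qed

section \<open>Greatest common divisors from integer and real valuations\<close>

lemma is_seq_gcd_zero: "is_seq_gcd (0 :: 'a::comm_ring_1) f \<longleftrightarrow> (\<forall>n. f n = 0)"
  unfolding is_seq_gcd_def by (metis dvd_0_left_iff dvd_0_right)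

text \<open>By well-ordering some term has least value and divides all others. Values are
  nonnegative, so \<open>nat\<close> preserves their order.\<close>

lemma exists_seq_gcd_int:
  fixes v :: "'a::idom \<Rightarrow> int" and f :: "nat \<Rightarrow> 'a"
  assumes "divisibility_valuation v"
  shows "\<exists>c. is_seq_gcd c f"
proof (cases "\<forall>n. f n = 0")
  case True
  then show ?thesis
    using is_seq_gcd_zero by blast
next
  case False
  interpret divisibility_valuation v by fact
  obtain k where "f k \<noteq> 0"
    using False by blast
  then obtain m where m: "f m \<noteq> 0" "\<And>n. f n \<noteq> 0 \<Longrightarrow> nat (v (f m)) \<le> nat (v (f n))"
    using ex_has_least_nat[of "\<lambda>n. f n \<noteq> 0" k "\<lambda>n. nat (v (f n))"] by blast
  have "f m dvd f n" for n
  proof (cases "f n = 0")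
    case False
    then show ?thesis
      using m(2)[of n] val_nonneg[of "f n"] m(1) by (simp add: dvd_iff nat_le_eq_zle)
  qed simp
  then have "is_seq_gcd (f m) f"
    unfolding is_seq_gcd_def by (meson dvd_trans)
  then show ?thesis ..
qed

text \<open>If no term had the value of \<open>c\<close>, all nonzero terms would have value at
  least \<open>v c + 1\<close>, and \<open>c * p\<close> would be a common divisor of larger value
  than the gcd.\<close>

lemma seq_gcd_attained_int:
  fixes v :: "'a::idom \<Rightarrow> int"
  assumes v: "divisibility_valuation v" and p: "p \<noteq> 0" "v p = 1"
    and c: "is_seq_gcd c f" "c \<noteq> 0"
  shows "\<exists>n. f n \<noteq> 0 \<and> v (f n) = v c"
proof (rule ccontr)
  interpret divisibility_valuation v by fact
  assume no: "\<not> ?thesis"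
  have "c * p dvd f n" for n
  proof (cases "f n = 0")
    case False
    then have "v c \<le> v (f n)" "v (f n) \<noteq> v c"
      using is_seq_gcd_dvd[OF c(1), of n] dvd_iff[OF c(2) False] no by auto
    then show ?thesis
      using False c(2) p by (simp add: dvd_iff val_mult)
  qed simp
  then have "c * p dvd c"
    using c(1) by (simp add: is_seq_gcd_def)
  then show False
    using c(2) p by (simp add: dvd_iff val_mult)
qed

text \<open>The infimum of the values of the nonzero terms is a nonnegative real, and surjectivity
  provides an element with that value.\<close>

lemma exists_seq_gcd_real:
  fixes w :: "'a::idom \<Rightarrow> real" and f :: "nat \<Rightarrow> 'a"
  assumes w: "divisibility_valuation w" and onto: "\<And>g. 0 \<le> g \<Longrightarrow> \<exists>a. a \<noteq> 0 \<and> w a = g"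
  shows "\<exists>c. is_seq_gcd c f"
proof (cases "\<forall>n. f n = 0")
  case True
  then show ?thesis
    using is_seq_gcd_zero by blast
next
  case False
  interpret divisibility_valuation w by fact
  define A where "A = w ` {f n | n. f n \<noteq> 0}"
  have A: "A \<noteq> {}" "bdd_below A" "\<And>x. x \<in> A \<Longrightarrow> 0 \<le> x"
    using False val_nonneg unfolding A_def by (auto intro!: bdd_belowI[of _ 0])
  then have "0 \<le> Inf A"
    by (intro cInf_greatest)
  then obtain c where c: "c \<noteq> 0" "w c = Inf A"
    using onto by blast
  have c_dvd: "c dvd f n" for n
  proof (cases "f n = 0")
    case nz: False
    then have "w (f n) \<in> A"
      by (auto simp: A_def)
    then show ?thesis
      using A(2) nz c by (simp add: dvd_iff cInf_lower)
  qed simp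
  have "x dvd c" if x: "\<And>n. x dvd f n" for x
  proof -
    have "x \<noteq> 0"
      using x False by force
    then have "w x \<le> y" if "y \<in> A" for y
      using that x dvd_iff by (auto simp: A_def)
    then show ?thesis
      using A(1) c \<open>x \<noteq> 0\<close> by (simp add: dvd_iff cInf_greatest)
  qed
  with c_dvd have "is_seq_gcd c f"
    unfolding is_seq_gcd_def by (meson dvd_trans)
  then show ?thesis ..
qed

text \<open>Otherwise the gcd times an element of value \<open>e\<close> would still divide every
  term.\<close>

lemma seq_gcd_approximated_real:
  fixes w :: "'a::idom \<Rightarrow> real"
  assumes w: "divisibility_valuation w" and onto: "\<And>g. 0 \<le> g \<Longrightarrow> \<exists>a. a \<noteq> 0 \<and> w a = g"
    and c: "is_seq_gcd c f" "c \<noteq> 0" and "0 < e"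
  shows "\<exists>n. f n \<noteq> 0 \<and> w (f n) < w c + e"
proof (rule ccontr)
  interpret divisibility_valuation w by fact
  assume no: "\<not> ?thesis"
  obtain p where p: "p \<noteq> 0" "w p = e"
    using onto[of e] \<open>0 < e\<close> by auto
  have "c * p dvd f n" for n
  proof (cases "f n = 0")
    case False
    then show ?thesis
      using no c(2) p by (auto simp: dvd_iff val_mult not_less)
  qed simp
  then have "c * p dvd c"
    using c(1) by (simp add: is_seq_gcd_def)
  then show False
    using c(2) p \<open>0 < e\<close> by (simp add: dvd_iff val_mult)
qed

section \<open>From valuations to Gaussian algebras, and the equivalence\<close>

lemma gaussian_fps_of_int_valuation:
  fixes v :: "'a::idom \<Rightarrow> int"
  assumes v: "divisibility_valuation v" and onto: "\<And>g. 0 \<le> g \<Longrightarrow> \<exists>a. a \<noteq> 0 \<and> v a = g"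
    and total: "\<And>a b :: 'a. a dvd b \<or> b dvd a"
  shows "gaussian_algebra (ring_of_type_algebra :: 'a ring) ring_of_type_algebra fps_const"
proof (rule gaussian_fpsI[OF total exists_seq_gcd_int[OF v]])
  interpret divisibility_valuation v by fact
  obtain p where p: "p \<noteq> 0" "v p = 1"
    using onto[of 1] by auto
  \<comment> \<open>Reading the integer values as reals makes the Gauss norm argument, with its real
    parameter \<open>s\<close>, available.\<close>
  define w where "w a = real_of_int (v a)" for a
  have "divisibility_valuation w"
    by unfold_locales (simp_all add: w_def val_mult dvd_iff)
  moreover have "\<exists>n. f n \<noteq> 0 \<and> w (f n) < w c + e"
    if "is_seq_gcd c f" "c \<noteq> 0" "0 < e" for c f e
    using seq_gcd_attained_int[OF v p that(1,2)] that(3) by (auto simp: w_def)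
  ultimately show "is_seq_gcd (c * d) (fps_nth (f * g))"
    if "is_seq_gcd c (fps_nth f)" "is_seq_gcd d (fps_nth g)" for c d :: 'a and f g
    using that by (rule is_seq_gcd_fps_mult)
qed

lemma gaussian_fps_of_real_valuation:
  fixes w :: "'a::idom \<Rightarrow> real"
  assumes w: "divisibility_valuation w" and onto: "\<And>g. 0 \<le> g \<Longrightarrow> \<exists>a. a \<noteq> 0 \<and> w a = g"
    and total: "\<And>a b :: 'a. a dvd b \<or> b dvd a"
  shows "gaussian_algebra (ring_of_type_algebra :: 'a ring) ring_of_type_algebra fps_const"
  by (rule gaussian_fpsI[OF total exists_seq_gcd_real[OF w onto]
        is_seq_gcd_fps_mult[OF w seq_gcd_approximated_real[OF w onto]]])

text \<open>The gcds yield the archimedean property and thus a real valuation; the two alternatives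
  correspond to whether it has a least positive value.\<close>

lemma int_or_real_valuation_of_seq_gcds:
  fixes u :: "'a::idom"
  assumes total: "\<And>a b :: 'a. a dvd b \<or> b dvd a"
    and gcds: "\<And>f :: nat \<Rightarrow> 'a. \<exists>c. is_seq_gcd c f"
    and u: "u \<noteq> 0" "\<not> u dvd 1"
  shows "(\<exists>v :: 'a \<Rightarrow> int. divisibility_valuation v \<and> (\<forall>g\<ge>0. \<exists>a. a \<noteq> 0 \<and> v a = g)) \<or>
    (\<exists>w :: 'a \<Rightarrow> real. divisibility_valuation w \<and> (\<forall>g\<ge>0. \<exists>a. a \<noteq> 0 \<and> w a = g))"
proof -
  obtain w :: "'a \<Rightarrow> real" where w: "divisibility_valuation w"
    using exists_real_valuation[OF total archimedean_of_seq_gcds[OF total gcds] u] by blast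
  interpret divisibility_valuation w by fact
  have "0 < w u"
    using dvd_iff[of u 1] u by simp
  show ?thesis
  proof (cases "\<exists>p. p \<noteq> 0 \<and> 0 < w p \<and> (\<forall>a. a \<noteq> 0 \<longrightarrow> 0 < w a \<longrightarrow> w p \<le> w a)")
    case True
    then show ?thesis
      using int_valuation_of_least_value[OF w] by blast
  next
    case False
    then have "\<exists>a. a \<noteq> 0 \<and> 0 < w a \<and> w a < w p" if "p \<noteq> 0" "0 < w p" for p
      using that by (meson not_le)
    then have "\<exists>a. a \<noteq> 0 \<and> w a = g" if "0 \<le> g" for g
      using real_valuation_onto_of_no_least_value[OF w gcds u(1) \<open>0 < w u\<close> _ that] by blast
    then show ?thesis
      using w by blast
  qed
qed

theorem corollary4p11:
  fixes V :: "'v::idom ring"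
    and VX :: "'v fps ring"
    and G :: "'v fract set ordered_group"
  assumes V: "V = ring_of_type_algebra"
    and VX: "VX = ring_of_type_algebra"
    and G: "G = value_group"
    and valuation_ring: "valuation_ring V"
    and nontrivial: "carrier G \<noteq> {\<one>\<^bsub>G\<^esub>}"
  shows "(ohm_rush_algebra V VX fps_const \<longleftrightarrow> gaussian_algebra V VX fps_const) \<and>
         (gaussian_algebra V VX fps_const \<longleftrightarrow>
            ordered_group_isomorphic G (additive_ordered_group :: real ordered_group) \<or>
            ordered_group_isomorphic G (additive_ordered_group :: int ordered_group))"
proof -
  have total: "a dvd b \<or> b dvd a" for a b :: 'v
    using valuation_ring_dvd_total valuation_ring unfolding V by blast
  obtain u :: 'v where u: "u \<noteq> 0" "\<not> u dvd 1"
    using nontrivial_value_group nontrivial unfolding G by blast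
  let ?iso = "ordered_group_isomorphic G (additive_ordered_group :: real ordered_group) \<or>
    ordered_group_isomorphic G (additive_ordered_group :: int ordered_group)"
  \<comment> \<open>The equivalence is closed as a cycle: Ohm-Rush gives the isomorphism, this gives
    Gaussian, and Gaussian algebras are Ohm-Rush by definition.\<close>
  have "?iso" if "ohm_rush_algebra V VX fps_const"
  proof -
    have "\<exists>c. is_seq_gcd c f" for f :: "nat \<Rightarrow> 'v"
      using that unfolding V VX ohm_rush_fps_iff[OF total] by blast
    then show ?thesis
      using int_or_real_valuation_of_seq_gcds[OF total _ u]
        divisibility_valuation.value_group_isomorphic unfolding G by metis
  qed
  moreover have "gaussian_algebra V VX fps_const" if "?iso"
    using that
  proof
    assume "ordered_group_isomorphic G (additive_ordered_group :: real ordered_group)"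
    then obtain w :: "'v \<Rightarrow> real" where "divisibility_valuation w"
        "\<And>g. 0 \<le> g \<Longrightarrow> \<exists>a. a \<noteq> 0 \<and> w a = g"
      using divisibility_valuation_of_isomorphic unfolding G by blast
    then show ?thesis
      unfolding V VX using total by (rule gaussian_fps_of_real_valuation)
  next
    assume "ordered_group_isomorphic G (additive_ordered_group :: int ordered_group)"
    then obtain v :: "'v \<Rightarrow> int" where "divisibility_valuation v"
        "\<And>g. 0 \<le> g \<Longrightarrow> \<exists>a. a \<noteq> 0 \<and> v a = g"
      using divisibility_valuation_of_isomorphic unfolding G by blast
    then show ?thesis
      unfolding V VX using total by (rule gaussian_fps_of_int_valuation)
  qed
  moreover have "ohm_rush_algebra V VX fps_const" if "gaussian_algebra V VX fps_const"
    using that by (rule gaussian_algebra.axioms)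
  ultimately show ?thesis
    by blast
qed

end
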